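(* The category whose objects are ordered categories with restrictions and whose morphisms are order-preserving functors is isomorphic to the category whose objects are constellations with range and whose morphisms are range radiants.
   Context: Categories (object-free). A category is a class $C$ with a partial binary operation $\circ$ such that: (C1) $x\circ(y\circ z)$ exists iff $(x\circ y)\circ z$ exists, and then they are equal; (C2) if $x\circ y$ and $y\circ z$ exist then so does $x\circ(y\circ z)$; (C3) for each $x$ there are identities $e,f$ with $e\circ x$ and $x\circ f$ existing, where an identity is an element $e$ such that $x\circ e=x$ whenever $x\circ e$ exists and $e\circ x=x$ whenever $e\circ x$ exists. These $e,f$ are unique and written $D(x)=e$, $R(x)=f$; $x\circ y$ exists iff $R(x)=D(y)$. $D(C)=\{D(x)\mid x\in C\}$. An ordered category with restrictions is a category $(C,\circ,D,R)$ with a partial order $\leq$ such that: (O1) if $a\leq b$, $c\leq d$ and $a\circ c$, $b\circ d$ exist then $a\circ c\leq b\circ d$; (O2) $a\leq b$ implies $D(a)\leq D(b)$; (O2$'$) $a\leq b$ implies $R(a)\leq R(b)$; (O3) if $s\in C$, $e\in D(C)$ and $e\leq D(s)$, then there is a unique $x\in C$ with $x\leq s$ and $D(x)=e$. A functor $\rho$ between ordered categories with restrictions is order-preserving if $s\leq t$ implies $s\rho\leq t\rho$. A constellation is a class $Q$ with a partial binary operation $\cdot$ such that: (Q1) if $x\cdot(y\cdot z)$ exists then $(x\cdot y)\cdot z$ exists and they are equal; (Q2) if $x\cdot y$ and $y\cdot z$ exist then so does $x\cdot(y\cdot z)$; (Q3) for each $x\in Q$ there is a unique right identity $e$ with $e\cdot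 x=x$ (a right identity is an $e$ such that $x\cdot e=x$ whenever $x\cdot e$ exists); put $D(x)=e$ and $D(Q)=\{D(x)\mid x\in Q\}$. For $e,f\in D(Q)$ write $e\leq f$ iff $e\cdot f$ exists. A constellation with range is a constellation in which for each $s$ the set $\{e\in D(Q)\mid s\cdot e\text{ exists, and for all }f\in D(Q),\ s\cdot f\text{ exists implies }e\leq f\}$ has exactly one element, denoted $R(s)$, and such that $R(R(s)\cdot t)=R(s\cdot t)$ whenever $s\cdot t$ exists. A range radiant $\rho:Q_1\to Q_2$ between constellations with range is a function such that $D(s\rho)=D(s)\rho$ and $R(s\rho)=R(s)\rho$ for all $s$, and whenever $s\cdot t$ exists then $(s\rho)\cdot(t\rho)$ exists and $(s\cdot t)\rho=(s\rho)\cdot(t\rho)$. *)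

theory Defs
  imports Main "HOL-Library.FuncSet"
begin

section \<open>Sets with a partial binary operation\<close>

text \<open>
  \<^term>\<open>None\<close> means that the product does not exist. Structures are \<^emph>\<open>extensional\<close>: a product can
  exist only if the factors lie in the carrier. Hence two structures are equal as records iff they
  have the same elements, the same products (and the same order), so that equality of records is
  the right notion of equality of objects in an isomorphism of categories.
\<close>

record 'a pmagma =
  carrier :: "'a set"
  pmult :: "'a \<Rightarrow> 'a \<Rightarrow> 'a option"  (infixl "\<cdot>\<index>" 70)

record 'a ordered_pmagma = "'a pmagma" +
  order_rel :: "('a \<times> 'a) set"

locale partial_magma =
  fixes C (structure)
  assumes pmult_in_carrier:
    "x \<cdot> y = Some z \<Longrightarrow> x \<in> carrier C \<and> y \<in> carrier C \<and> z \<in> carrier C"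

text \<open>Iterated products: each exists iff the inner and then the outer product exists.\<close>

definition prod_right :: "('a, 'b) pmagma_scheme \<Rightarrow> 'a \<Rightarrow> 'a \<Rightarrow> 'a \<Rightarrow> 'a option" where
  "prod_right C x y z = Option.bind (y \<cdot>\<^bsub>C\<^esub> z) (\<lambda>w. x \<cdot>\<^bsub>C\<^esub> w)"

definition prod_left :: "('a, 'b) pmagma_scheme \<Rightarrow> 'a \<Rightarrow> 'a \<Rightarrow> 'a \<Rightarrow> 'a option" where
  "prod_left C x y z = Option.bind (x \<cdot>\<^bsub>C\<^esub> y) (\<lambda>w. w \<cdot>\<^bsub>C\<^esub> z)"

definition right_identity :: "('a, 'b) pmagma_scheme \<Rightarrow> 'a \<Rightarrow> bool" where
  "right_identity C e \<longleftrightarrow>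
     e \<in> carrier C \<and> (\<forall>x\<in>carrier C. x \<cdot>\<^bsub>C\<^esub> e \<noteq> None \<longrightarrow> x \<cdot>\<^bsub>C\<^esub> e = Some x)"

definition identity :: "('a, 'b) pmagma_scheme \<Rightarrow> 'a \<Rightarrow> bool" where
  "identity C e \<longleftrightarrow>
     right_identity C e \<and> (\<forall>x\<in>carrier C. e \<cdot>\<^bsub>C\<^esub> x \<noteq> None \<longrightarrow> e \<cdot>\<^bsub>C\<^esub> x = Some x)"


section \<open>Ordered categories with restrictions\<close>

text \<open>The underlying (small) categories are object-free.\<close>

locale object_free_category = partial_magma +
  assumes C1: "\<lbrakk>x \<in> carrier C; y \<in> carrier C; z \<in> carrier C\<rbrakk>
      \<Longrightarrow> (prod_right C x y z \<noteq> None \<longleftrightarrow> prod_left C x y z \<noteq> None)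
        \<and> (prod_right C x y z \<noteq> None \<longrightarrow> prod_right C x y z = prod_left C x y z)"
    and C2: "\<lbrakk>x \<in> carrier C; y \<in> carrier C; z \<in> carrier C; x \<cdot> y \<noteq> None; y \<cdot> z \<noteq> None\<rbrakk>
      \<Longrightarrow> prod_right C x y z \<noteq> None"
    and C3: "x \<in> carrier C
      \<Longrightarrow> \<exists>e f. identity C e \<and> identity C f \<and> e \<cdot> x \<noteq> None \<and> x \<cdot> f \<noteq> None"

definition cat_D :: "('a, 'b) pmagma_scheme \<Rightarrow> 'a \<Rightarrow> 'a" where
  "cat_D C x = (THE e. identity C e \<and> e \<cdot>\<^bsub>C\<^esub> x \<noteq> None)"

definition cat_R :: "('a, 'b) pmagma_scheme \<Rightarrow> 'a \<Rightarrow> 'a" where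
  "cat_R C x = (THE f. identity C f \<and> x \<cdot>\<^bsub>C\<^esub> f \<noteq> None)"

locale ordered_category_with_restrictions = object_free_category C
  for C :: "('a, 'b) ordered_pmagma_scheme" (structure) +
  assumes partial_order: "partial_order_on (carrier C) (order_rel C)"
    and O1: "\<lbrakk>(a, b) \<in> order_rel C; (c, d) \<in> order_rel C; a \<cdot> c = Some u; b \<cdot> d = Some v\<rbrakk>
      \<Longrightarrow> (u, v) \<in> order_rel C"
    and O2: "(a, b) \<in> order_rel C \<Longrightarrow> (cat_D C a, cat_D C b) \<in> order_rel C"
    and O2': "(a, b) \<in> order_rel C \<Longrightarrow> (cat_R C a, cat_R C b) \<in> order_rel C"
    and O3: "\<lbrakk>s \<in> carrier C; e \<in> cat_D C ` carrier C; (e, cat_D C s) \<in> order_rel C\<rbrakk>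
      \<Longrightarrow> \<exists>!x. x \<in> carrier C \<and> (x, s) \<in> order_rel C \<and> cat_D C x = e"

text \<open>Maps are extensional (\<^term>\<open>undefined\<close> off the carrier), so that equality of maps is equality
  of their values on the carrier.\<close>

definition order_preserving_functor ::
    "'a ordered_pmagma \<Rightarrow> 'a ordered_pmagma \<Rightarrow> ('a \<Rightarrow> 'a) \<Rightarrow> bool" where
  "order_preserving_functor A B \<rho> \<longleftrightarrow>
     \<rho> \<in> carrier A \<rightarrow>\<^sub>E carrier B \<and>
     (\<forall>s\<in>carrier A. \<rho> (cat_D A s) = cat_D B (\<rho> s) \<and> \<rho> (cat_R A s) = cat_R B (\<rho> s)) \<and>
     (\<forall>s t u. s \<cdot>\<^bsub>A\<^esub> t = Some u \<longrightarrow> \<rho> s \<cdot>\<^bsub>B\<^esub> \<rho> t = Some (\<rho> u)) \<and>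
     (\<forall>s t. (s, t) \<in> order_rel A \<longrightarrow> (\<rho> s, \<rho> t) \<in> order_rel B)"


section \<open>Constellations with range\<close>

locale constellation = partial_magma Q for Q (structure) +
  assumes Q1: "\<lbrakk>x \<in> carrier Q; y \<in> carrier Q; z \<in> carrier Q; prod_right Q x y z \<noteq> None\<rbrakk>
      \<Longrightarrow> prod_left Q x y z \<noteq> None \<and> prod_right Q x y z = prod_left Q x y z"
    and Q2: "\<lbrakk>x \<in> carrier Q; y \<in> carrier Q; z \<in> carrier Q; x \<cdot> y \<noteq> None; y \<cdot> z \<noteq> None\<rbrakk>
      \<Longrightarrow> prod_right Q x y z \<noteq> None"
    and Q3: "x \<in> carrier Q \<Longrightarrow> \<exists>!e. right_identity Q e \<and> e \<cdot> x = Some x"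

definition con_D :: "('a, 'b) pmagma_scheme \<Rightarrow> 'a \<Rightarrow> 'a" where
  "con_D Q x = (THE e. right_identity Q e \<and> e \<cdot>\<^bsub>Q\<^esub> x = Some x)"

text \<open>The order \<open>e \<le> f\<close> on \<open>D(Q)\<close> is existence of \<open>e \<cdot> f\<close>.\<close>

definition con_range_set :: "('a, 'b) pmagma_scheme \<Rightarrow> 'a \<Rightarrow> 'a set" where
  "con_range_set Q s =
     {e \<in> con_D Q ` carrier Q. s \<cdot>\<^bsub>Q\<^esub> e \<noteq> None \<and>
        (\<forall>f \<in> con_D Q ` carrier Q. s \<cdot>\<^bsub>Q\<^esub> f \<noteq> None \<longrightarrow> e \<cdot>\<^bsub>Q\<^esub> f \<noteq> None)}"

definition con_R :: "('a, 'b) pmagma_scheme \<Rightarrow> 'a \<Rightarrow> 'a" where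
  "con_R Q s = (THE e. e \<in> con_range_set Q s)"

locale constellation_with_range = constellation +
  assumes range_unique: "s \<in> carrier Q \<Longrightarrow> \<exists>!e. e \<in> con_range_set Q s"
    and range_congruence: "s \<cdot> t = Some u \<Longrightarrow> \<exists>v. con_R Q s \<cdot> t = Some v \<and> con_R Q v = con_R Q u"

definition range_radiant :: "'a pmagma \<Rightarrow> 'a pmagma \<Rightarrow> ('a \<Rightarrow> 'a) \<Rightarrow> bool" where
  "range_radiant Q1 Q2 \<rho> \<longleftrightarrow>
     \<rho> \<in> carrier Q1 \<rightarrow>\<^sub>E carrier Q2 \<and>
     (\<forall>s\<in>carrier Q1. con_D Q2 (\<rho> s) = \<rho> (con_D Q1 s) \<and> con_R Q2 (\<rho> s) = \<rho> (con_R Q1 s)) \<and>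
     (\<forall>s t u. s \<cdot>\<^bsub>Q1\<^esub> t = Some u \<longrightarrow> \<rho> s \<cdot>\<^bsub>Q2\<^esub> \<rho> t = Some (\<rho> u))"


section \<open>Categories with objects and arrows, and their isomorphism\<close>

text \<open>\<^term>\<open>Comp K f g\<close> is in diagrammatic order: first \<open>f\<close>, then \<open>g\<close>. Its value is irrelevant
  unless \<open>Cod K f = Dom K g\<close>.\<close>

record ('o, 'm) cat =
  Obj :: "'o set"
  Arr :: "'m set"
  Dom :: "'m \<Rightarrow> 'o"
  Cod :: "'m \<Rightarrow> 'o"
  Ident :: "'o \<Rightarrow> 'm"
  Comp :: "'m \<Rightarrow> 'm \<Rightarrow> 'm"

locale is_category =
  fixes K :: "('o, 'm) cat"
  assumes dom_cod: "f \<in> Arr K \<Longrightarrow> Dom K f \<in> Obj K \<and> Cod K f \<in> Obj K"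
    and ident: "X \<in> Obj K
      \<Longrightarrow> Ident K X \<in> Arr K \<and> Dom K (Ident K X) = X \<and> Cod K (Ident K X) = X"
    and comp: "\<lbrakk>f \<in> Arr K; g \<in> Arr K; Cod K f = Dom K g\<rbrakk>
      \<Longrightarrow> Comp K f g \<in> Arr K \<and> Dom K (Comp K f g) = Dom K f \<and> Cod K (Comp K f g) = Cod K g"
    and comp_ident: "f \<in> Arr K
      \<Longrightarrow> Comp K (Ident K (Dom K f)) f = f \<and> Comp K f (Ident K (Cod K f)) = f"
    and comp_assoc: "\<lbrakk>f \<in> Arr K; g \<in> Arr K; h \<in> Arr K; Cod K f = Dom K g; Cod K g = Dom K h\<rbrakk>
      \<Longrightarrow> Comp K (Comp K f g) h = Comp K f (Comp K g h)"

definition is_functor ::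
    "('o1, 'm1) cat \<Rightarrow> ('o2, 'm2) cat \<Rightarrow> ('o1 \<Rightarrow> 'o2) \<Rightarrow> ('m1 \<Rightarrow> 'm2) \<Rightarrow> bool" where
  "is_functor K L Fo Fm \<longleftrightarrow>
     (\<forall>X\<in>Obj K. Fo X \<in> Obj L \<and> Fm (Ident K X) = Ident L (Fo X)) \<and>
     (\<forall>f\<in>Arr K. Fm f \<in> Arr L \<and> Dom L (Fm f) = Fo (Dom K f) \<and> Cod L (Fm f) = Fo (Cod K f)) \<and>
     (\<forall>f\<in>Arr K. \<forall>g\<in>Arr K. Cod K f = Dom K g \<longrightarrow> Fm (Comp K f g) = Comp L (Fm f) (Fm g))"

definition isomorphic_categories :: "('o1, 'm1) cat \<Rightarrow> ('o2, 'm2) cat \<Rightarrow> bool" where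
  "isomorphic_categories K L \<longleftrightarrow>
     is_category K \<and> is_category L \<and>
     (\<exists>Fo Fm Go Gm. is_functor K L Fo Fm \<and> is_functor L K Go Gm \<and>
        (\<forall>X\<in>Obj K. Go (Fo X) = X) \<and> (\<forall>f\<in>Arr K. Gm (Fm f) = f) \<and>
        (\<forall>Y\<in>Obj L. Fo (Go Y) = Y) \<and> (\<forall>g\<in>Arr L. Fm (Gm g) = g))"

text \<open>The category with the given structures as objects and the given maps as morphisms. An arrow
  is a map together with its source and target.\<close>

definition category_of_structures ::
    "('s \<Rightarrow> 'a set) \<Rightarrow> 's set \<Rightarrow> ('s \<Rightarrow> 's \<Rightarrow> ('a \<Rightarrow> 'a) \<Rightarrow> bool) \<Rightarrow> ('s, 's \<times> ('a \<Rightarrow> 'a) \<times> 's) cat" where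
  "category_of_structures U S H =
     \<lparr> Obj = S,
       Arr = {(A, \<rho>, B). A \<in> S \<and> B \<in> S \<and> H A B \<rho>},
       Dom = (\<lambda>(A, \<rho>, B). A),
       Cod = (\<lambda>(A, \<rho>, B). B),
       Ident = (\<lambda>A. (A, restrict id (U A), A)),
       Comp = (\<lambda>(A, \<rho>, B) (B', \<sigma>, C). (A, compose (U A) \<sigma> \<rho>, C)) \<rparr>"

type_synonym 'a ordered_pmagma_arrow = "'a ordered_pmagma \<times> ('a \<Rightarrow> 'a) \<times> 'a ordered_pmagma"
type_synonym 'a pmagma_arrow = "'a pmagma \<times> ('a \<Rightarrow> 'a) \<times> 'a pmagma"

text \<open>The type \<^typ>\<open>'a\<close> serves as the universe: the objects are all structures carried by (possibly
  empty) subsets of it.\<close>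

definition ordered_categories_with_restrictions ::
    "('a ordered_pmagma, 'a ordered_pmagma_arrow) cat" where
  "ordered_categories_with_restrictions =
     category_of_structures carrier {C. ordered_category_with_restrictions C} order_preserving_functor"

definition constellations_with_range :: "('a pmagma, 'a pmagma_arrow) cat" where
  "constellations_with_range =
     category_of_structures carrier {Q. constellation_with_range Q} range_radiant"

end

theory Submission
  imports Defs
begin

text \<open>
  An ordered category with restrictions becomes a constellation by letting \<open>x \<cdot> y\<close> exist iff
  \<open>R(x) \<le> D(y)\<close>, with value \<open>x \<circ> (R(x)|y)\<close>, where \<open>(e|y)\<close> is the restriction of \<open>y\<close> to \<open>e\<close>.
  Conversely, in a constellation with range, \<open>x \<circ> y\<close> is \<open>x \<cdot> y\<close> restricted to the pairs with
  \<open>R(x) = D(y)\<close>, and \<open>x \<le> y\<close> iff \<open>x = D(x) \<cdot> y\<close>. Both constructions preserve the carrier,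
  \<open>D\<close> and \<open>R\<close>, they are mutually inverse, and a map is an order-preserving functor iff it is a
  range radiant between the corresponding constellations.
\<close>

section \<open>Object-free categories\<close>

context object_free_category
begin

abbreviation D where "D \<equiv> cat_D C"
abbreviation R where "R \<equiv> cat_R C"

text \<open>C1 and C2 for products given as \<open>Some\<close>. The three variants differ in which
  two products are known to exist; only this one uses C2.\<close>

lemma mult_assoc:
  assumes "x \<cdot> y = Some u" "y \<cdot> z = Some v"
  obtains w where "x \<cdot> v = Some w" "u \<cdot> z = Some w"
proof -
  have "x \<in> carrier C" "y \<in> carrier C" "z \<in> carrier C"
    using assms pmult_in_carrier by blast+
  then show ?thesis
    using C1[of x y z] C2[of x y z] assms that by (auto simp: prod_left_def prod_right_def)
qed

lemma mult_assoc_left: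
  assumes "x \<cdot> y = Some u" "u \<cdot> z = Some w"
  obtains v where "y \<cdot> z = Some v" "x \<cdot> v = Some w"
proof -
  have "x \<in> carrier C" "y \<in> carrier C" "z \<in> carrier C"
    using assms pmult_in_carrier by blast+
  then have "prod_right C x y z = Some w"
    using C1[of x y z] assms by (auto simp: prod_left_def)
  then show ?thesis
    using that by (auto simp: prod_right_def bind_eq_Some_conv)
qed

lemma mult_assoc_right:
  assumes "y \<cdot> z = Some v" "x \<cdot> v = Some w"
  obtains u where "x \<cdot> y = Some u" "u \<cdot> z = Some w"
proof -
  have "x \<in> carrier C" "y \<in> carrier C" "z \<in> carrier C"
    using assms pmult_in_carrier by blast+
  then show ?thesis
    using C1[of x y z] assms that
    by (cases "x \<cdot> y") (auto simp: prod_left_def prod_right_def)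
qed

section \<open>Identities, domains and ranges\<close>

lemma identity_carrier: "identity C e \<Longrightarrow> e \<in> carrier C"
  by (simp add: identity_def right_identity_def)

lemma identity_mult_left: "identity C e \<Longrightarrow> e \<cdot> x = Some y \<Longrightarrow> y = x"
  using pmult_in_carrier[of e x y] unfolding identity_def
  by (metis option.distinct(1) option.inject)

lemma identity_mult_right: "identity C e \<Longrightarrow> x \<cdot> e = Some y \<Longrightarrow> y = x"
  using pmult_in_carrier[of x e y] unfolding identity_def right_identity_def
  by (metis option.distinct(1) option.inject)

text \<open>Since \<open>e \<cdot> x = x\<close>, the product \<open>f \<cdot> (e \<cdot> x)\<close>
  exists, so C1 makes \<open>f \<cdot> e\<close> exist; a product of two identities equals both
  factors.\<close>

lemma left_identity_unique:
  assumes "identity C e" "identity C f" "e \<cdot> x \<noteq> None" "f \<cdot> x \<noteq> None"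
  shows "e = f"
proof -
  have e: "e \<cdot> x = Some x" and f: "f \<cdot> x = Some x"
    using assms identity_mult_left by blast+
  obtain u where "f \<cdot> e = Some u"
    using mult_assoc_right[OF e f] by blast
  then show ?thesis
    using assms identity_mult_left identity_mult_right by blast
qed

lemma right_identity_unique:
  assumes "identity C e" "identity C f" "x \<cdot> e \<noteq> None" "x \<cdot> f \<noteq> None"
  shows "e = f"
proof -
  have e: "x \<cdot> e = Some x" and f: "x \<cdot> f = Some x"
    using assms identity_mult_right by blast+
  obtain u where "e \<cdot> f = Some u"
    using mult_assoc_left[OF e f] by blast
  then show ?thesis
    using assms identity_mult_left identity_mult_right by blast
qed

lemma D_eqI: "identity C e \<Longrightarrow> e \<cdot> x \<noteq> None \<Longrightarrow> D x = e"
  unfolding cat_D_def using left_identity_unique by (intro the_equality) blast+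

lemma R_eqI: "identity C e \<Longrightarrow> x \<cdot> e \<noteq> None \<Longrightarrow> R x = e"
  unfolding cat_R_def using right_identity_unique by (intro the_equality) blast+

lemma identity_D: "x \<in> carrier C \<Longrightarrow> identity C (D x)"
  using C3 D_eqI by blast

lemma identity_R: "x \<in> carrier C \<Longrightarrow> identity C (R x)"
  using C3 R_eqI by blast

lemma D_mult: "x \<in> carrier C \<Longrightarrow> D x \<cdot> x = Some x"
  using C3 D_eqI identity_mult_left by blast

lemma mult_R: "x \<in> carrier C \<Longrightarrow> x \<cdot> R x = Some x"
  using C3 R_eqI identity_mult_right by blast

lemma D_carrier [simp]: "x \<in> carrier C \<Longrightarrow> D x \<in> carrier C"
  using identity_D identity_carrier by blast

lemma R_carrier [simp]: "x \<in> carrier C \<Longrightarrow> R x \<in> carrier C"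
  using identity_R identity_carrier by blast

lemma D_identity: "identity C e \<Longrightarrow> D e = e"
  using identity_mult_right[OF _ D_mult[OF identity_carrier], of e] by simp

lemma R_identity: "identity C e \<Longrightarrow> R e = e"
  using identity_mult_left[OF _ mult_R[OF identity_carrier], of e] by simp

text \<open>Forward: write \<open>x\<close> as \<open>x \<cdot> R x\<close>; then
  \<open>R x \<cdot> y\<close> exists, so the identity \<open>R x\<close> is \<open>D y\<close>.
  Backward: C2 joins \<open>x \<cdot> R x\<close> and \<open>R x \<cdot> y\<close>.\<close>

lemma mult_iff:
  assumes "x \<in> carrier C" "y \<in> carrier C"
  shows "(\<exists>u. x \<cdot> y = Some u) \<longleftrightarrow> R x = D y"
proof
  assume "\<exists>u. x \<cdot> y = Some u"
  then obtain u where u: "x \<cdot> y = Some u"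
    by blast
  obtain v where "R x \<cdot> y = Some v"
    using mult_assoc_left[OF mult_R[OF assms(1)] u] by blast
  then show "R x = D y"
    using D_eqI identity_R assms by force
next
  assume "R x = D y"
  then have "R x \<cdot> y = Some y"
    using D_mult[OF assms(2)] by simp
  from mult_assoc[OF mult_R[OF assms(1)] this] show "\<exists>u. x \<cdot> y = Some u"
    by blast
qed

lemma mult_imp_R_eq_D: "x \<cdot> y = Some u \<Longrightarrow> R x = D y"
  using mult_iff pmult_in_carrier by blast

lemma D_of_mult:
  assumes "x \<cdot> y = Some u"
  shows "D u = D x"
proof -
  have x: "x \<in> carrier C"
    using assms pmult_in_carrier by blast
  obtain w where "D x \<cdot> u = Some w"
    using mult_assoc[OF D_mult[OF x] assms] by blast
  then show ?thesis
    using D_eqI identity_D x by force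
qed

lemma R_of_mult:
  assumes "x \<cdot> y = Some u"
  shows "R u = R y"
proof -
  have y: "y \<in> carrier C"
    using assms pmult_in_carrier by blast
  obtain w where "u \<cdot> R y = Some w"
    using mult_assoc[OF assms mult_R[OF y]] by blast
  then show ?thesis
    using R_eqI identity_R y by force
qed

end


section \<open>From ordered categories to constellations\<close>

text \<open>The element whose unique existence O3 asserts; meaningful only if \<open>e\<close> is an
  identity below the domain of \<open>s\<close>.\<close>

definition restriction :: "('a, 'b) ordered_pmagma_scheme \<Rightarrow> 'a \<Rightarrow> 'a \<Rightarrow> 'a" where
  "restriction C e s = (THE x. x \<in> carrier C \<and> (x, s) \<in> order_rel C \<and> cat_D C x = e)"

definition constellation_of :: "('a, 'b) ordered_pmagma_scheme \<Rightarrow> 'a pmagma" where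
  "constellation_of C =
     \<lparr> carrier = carrier C,
       pmult = (\<lambda>x y.
         if x \<in> carrier C \<and> y \<in> carrier C \<and> (cat_R C x, cat_D C y) \<in> order_rel C
         then x \<cdot>\<^bsub>C\<^esub> restriction C (cat_R C x) y else None) \<rparr>"

lemma carrier_constellation_of [simp]: "carrier (constellation_of C) = carrier C"
  by (simp add: constellation_of_def)

context ordered_category_with_restrictions
begin

abbreviation le (infix "\<preceq>" 50) where "x \<preceq> y \<equiv> (x, y) \<in> order_rel C"
abbreviation restr where "restr \<equiv> restriction C"
abbreviation Q where "Q \<equiv> constellation_of C"

section \<open>The order and restrictions\<close>

lemma le_carrier: "x \<preceq> y \<Longrightarrow> x \<in> carrier C \<and> y \<in> carrier C"
  using partial_order by (auto simp: partial_order_on_def preorder_on_def refl_on_def)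

lemma le_refl: "x \<in> carrier C \<Longrightarrow> x \<preceq> x"
  using partial_order by (auto simp: partial_order_on_def preorder_on_def refl_on_def)

lemma le_trans: "x \<preceq> y \<Longrightarrow> y \<preceq> z \<Longrightarrow> x \<preceq> z"
  using partial_order by (auto simp: partial_order_on_def preorder_on_def dest: transD)

lemma le_antisym: "x \<preceq> y \<Longrightarrow> y \<preceq> x \<Longrightarrow> x = y"
  using partial_order by (auto simp: partial_order_on_def dest: antisymD)

text \<open>The uniqueness half of O3, in the form used to identify two restrictions of one
  element.\<close>

lemma eq_of_le_of_D_eq:
  assumes "x \<preceq> s" "y \<preceq> s" "D x = D y"
  shows "x = y"
proof -
  have "x \<in> carrier C" "y \<in> carrier C" "s \<in> carrier C"
    using assms le_carrier by blast+
  then show ?thesis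
    using O3[of s "D x"] O2[OF assms(1)] assms by auto
qed

lemma restr_props:
  assumes "identity C e" "s \<in> carrier C" "e \<preceq> D s"
  shows "restr e s \<preceq> s \<and> D (restr e s) = e"
proof -
  have "e \<in> D ` carrier C"
    using assms(1) D_identity identity_carrier by (metis image_eqI)
  from theI'[OF O3[OF assms(2) this assms(3)]] show ?thesis
    by (simp add: restriction_def)
qed

lemma restr_eqI: "x \<preceq> s \<Longrightarrow> D x = e \<Longrightarrow> restr e s = x"
  unfolding restriction_def using eq_of_le_of_D_eq le_carrier by (intro the_equality) blast+

lemma Q_mult_eq:
  assumes "x \<in> carrier C" "z \<preceq> y" "D z = R x"
  shows "x \<cdot>\<^bsub>Q\<^esub> y = x \<cdot> z"
  using assms O2[OF assms(2)] le_carrier[OF assms(2)] restr_eqI[OF assms(2)]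
  by (simp add: constellation_of_def)

text \<open>Products in the constellation are handled through the witness \<open>y' = (R(x)|y)\<close>, which
  avoids the definite description.\<close>

lemma Q_mult_iff:
  "x \<cdot>\<^bsub>Q\<^esub> y = Some u \<longleftrightarrow> (\<exists>y'. y' \<preceq> y \<and> x \<cdot> y' = Some u)"
proof
  assume *: "x \<cdot>\<^bsub>Q\<^esub> y = Some u"
  then have "x \<in> carrier C" "y \<in> carrier C" "R x \<preceq> D y" "x \<cdot> restr (R x) y = Some u"
    by (auto simp: constellation_of_def split: if_splits)
  then show "\<exists>y'. y' \<preceq> y \<and> x \<cdot> y' = Some u"
    using restr_props identity_R by blast
next
  assume "\<exists>y'. y' \<preceq> y \<and> x \<cdot> y' = Some u"
  then show "x \<cdot>\<^bsub>Q\<^esub> y = Some u"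
    using Q_mult_eq mult_imp_R_eq_D pmult_in_carrier by metis
qed

lemma Q_mult_exists_iff:
  assumes "x \<in> carrier C" "y \<in> carrier C"
  shows "(\<exists>u. x \<cdot>\<^bsub>Q\<^esub> y = Some u) \<longleftrightarrow> R x \<preceq> D y"
proof
  assume "\<exists>u. x \<cdot>\<^bsub>Q\<^esub> y = Some u"
  then show "R x \<preceq> D y"
    using Q_mult_iff O2 mult_imp_R_eq_D by metis
next
  assume "R x \<preceq> D y"
  then have r: "restr (R x) y \<preceq> y" "D (restr (R x) y) = R x"
    using restr_props identity_R assms by blast+
  then have "\<exists>u. x \<cdot> restr (R x) y = Some u"
    using mult_iff assms le_carrier by metis
  then show "\<exists>u. x \<cdot>\<^bsub>Q\<^esub> y = Some u"
    using Q_mult_iff r by blast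
qed

section \<open>Right identities, domains and ranges in the constellation\<close>

lemma Q_mult_identity:
  assumes "x \<in> carrier C" "identity C e" "R x \<preceq> e"
  shows "x \<cdot>\<^bsub>Q\<^esub> e = Some x"
  using assms Q_mult_iff mult_R by blast

text \<open>A right identity \<open>e\<close> makes the product of \<open>D e\<close> and
  \<open>e\<close> equal to both \<open>e\<close> and \<open>D e\<close>. Conversely, if
  \<open>R x\<close> lies below an identity \<open>e\<close>, then \<open>R x\<close> is the
  restriction of \<open>e\<close>, and \<open>x \<cdot> R x = x\<close>.\<close>

lemma right_identity_Q_iff: "right_identity Q e \<longleftrightarrow> identity C e"
proof
  assume e: "right_identity Q e"
  then have c: "e \<in> carrier C"
    by (simp add: right_identity_def)
  then have "D e \<cdot>\<^bsub>Q\<^esub> e = Some e"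
    using Q_mult_iff D_mult le_refl by blast
  then have "e = D e"
    using e c by (auto simp: right_identity_def)
  then show "identity C e"
    using identity_D[OF c] by simp
next
  assume e: "identity C e"
  then have c: "e \<in> carrier C"
    by (rule identity_carrier)
  have "x \<cdot>\<^bsub>Q\<^esub> e = Some x" if "x \<in> carrier C" "x \<cdot>\<^bsub>Q\<^esub> e \<noteq> None" for x
    using Q_mult_identity[OF that(1) e] Q_mult_exists_iff[OF that(1) c] that(2) D_identity[OF e]
    by auto
  then show "right_identity Q e"
    using c by (simp add: right_identity_def)
qed

lemma Q_left_unit_iff:
  assumes "x \<in> carrier C"
  shows "right_identity Q e \<and> e \<cdot>\<^bsub>Q\<^esub> x = Some x \<longleftrightarrow> e = D x"
proof
  assume "right_identity Q e \<and> e \<cdot>\<^bsub>Q\<^esub> x = Some x"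
  then show "e = D x"
    using right_identity_Q_iff Q_mult_iff D_of_mult D_identity by metis
next
  assume "e = D x"
  then show "right_identity Q e \<and> e \<cdot>\<^bsub>Q\<^esub> x = Some x"
    using right_identity_Q_iff Q_mult_iff identity_D D_mult le_refl assms by blast
qed

lemma con_D_Q: "x \<in> carrier C \<Longrightarrow> con_D Q x = D x"
  by (simp add: con_D_def Q_left_unit_iff)

lemma con_D_Q_image: "con_D Q ` carrier Q = {e. identity C e}"
proof -
  have "con_D Q ` carrier Q = D ` carrier C"
    by (simp add: con_D_Q)
  also have "\<dots> = {e. identity C e}"
    using D_identity identity_D identity_carrier by (auto simp: image_iff) metis
  finally show ?thesis .
qed

text \<open>For an identity \<open>e\<close>, the product of \<open>s\<close> and \<open>e\<close>
  exists iff \<open>R s\<close> lies below \<open>e\<close>. The range set therefore consists of the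
  least identities above \<open>R s\<close>, and antisymmetry leaves only
  \<open>R s\<close>.\<close>

lemma con_range_set_Q:
  assumes "s \<in> carrier C"
  shows "con_range_set Q s = {R s}"
proof -
  have m: "x \<cdot>\<^bsub>Q\<^esub> e \<noteq> None \<longleftrightarrow> R x \<preceq> e" if "x \<in> carrier C" "identity C e" for x e
    using Q_mult_exists_iff[OF that(1) identity_carrier[OF that(2)]] D_identity[OF that(2)] by auto
  have "e \<in> con_range_set Q s \<longleftrightarrow>
      identity C e \<and> R s \<preceq> e \<and> (\<forall>f. identity C f \<longrightarrow> R s \<preceq> f \<longrightarrow> e \<preceq> f)" for e
    unfolding con_range_set_def con_D_Q_image
    using m assms identity_carrier R_identity by auto
  then show ?thesis
    using identity_R le_refl R_carrier le_antisym assms by blast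
qed

lemma con_R_Q: "s \<in> carrier C \<Longrightarrow> con_R Q s = R s"
  by (simp add: con_R_def con_range_set_Q)

section \<open>The constellation axioms\<close>

lemma Q_mult_carrier:
  "x \<cdot>\<^bsub>Q\<^esub> y = Some u \<Longrightarrow> x \<in> carrier C \<and> y \<in> carrier C \<and> u \<in> carrier C"
  using Q_mult_iff le_carrier pmult_in_carrier by blast

text \<open>A composite of restrictions is a restriction of the composite: \<open>v'\<close> and
  \<open>t\<close>, the composite of \<open>y'\<close> and \<open>z''\<close>, both lie below
  \<open>v\<close> and have domain \<open>R x\<close>, so they coincide. Associativity in
  \<open>C\<close> then finishes the proof.\<close>

lemma Q_mult_assoc:
  assumes "y \<cdot>\<^bsub>Q\<^esub> z = Some v" "x \<cdot>\<^bsub>Q\<^esub> v = Some w"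
  shows "\<exists>u. x \<cdot>\<^bsub>Q\<^esub> y = Some u \<and> u \<cdot>\<^bsub>Q\<^esub> z = Some w"
proof -
  obtain z' where z': "z' \<preceq> z" "y \<cdot> z' = Some v"
    using assms(1) Q_mult_iff by blast
  obtain v' where v': "v' \<preceq> v" "x \<cdot> v' = Some w"
    using assms(2) Q_mult_iff by blast
  have car: "x \<in> carrier C" "y \<in> carrier C" "z' \<in> carrier C"
    using v' z' pmult_in_carrier by blast+
  have "R x \<preceq> D y"
    using O2[OF v'(1)] mult_imp_R_eq_D[OF v'(2)] D_of_mult[OF z'(2)] by simp
  then obtain u where u: "x \<cdot>\<^bsub>Q\<^esub> y = Some u"
    using Q_mult_exists_iff car by blast
  then obtain y' where y': "y' \<preceq> y" "x \<cdot> y' = Some u"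
    using Q_mult_iff by blast
  have y'c: "y' \<in> carrier C"
    using le_carrier y' by blast
  have "R y' \<preceq> D z'"
    using O2'[OF y'(1)] mult_imp_R_eq_D[OF z'(2)] by simp
  then obtain t where "y' \<cdot>\<^bsub>Q\<^esub> z' = Some t"
    using Q_mult_exists_iff y'c car by blast
  then obtain z'' where z'': "z'' \<preceq> z'" "y' \<cdot> z'' = Some t"
    using Q_mult_iff by blast
  have "t \<preceq> v"
    using O1[OF y'(1) z''(1) z''(2) z'(2)] .
  moreover have "D t = D v'"
    using D_of_mult[OF z''(2)] mult_imp_R_eq_D[OF y'(2)] mult_imp_R_eq_D[OF v'(2)] by simp
  ultimately have "t = v'"
    using eq_of_le_of_D_eq v'(1) by blast
  then have "u \<cdot> z'' = Some w"
    using mult_assoc[OF y'(2) z''(2)] v'(2) by auto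
  then show ?thesis
    using u Q_mult_iff le_trans z' z'' by blast
qed

lemma constellation_with_range_Q: "constellation_with_range Q"
proof unfold_locales
  show "x \<in> carrier Q \<and> y \<in> carrier Q \<and> z \<in> carrier Q" if "x \<cdot>\<^bsub>Q\<^esub> y = Some z" for x y z
    using Q_mult_carrier that by simp
  show "prod_left Q x y z \<noteq> None \<and> prod_right Q x y z = prod_left Q x y z"
    if "prod_right Q x y z \<noteq> None" for x y z
  proof -
    from that obtain v w where "y \<cdot>\<^bsub>Q\<^esub> z = Some v" "x \<cdot>\<^bsub>Q\<^esub> v = Some w"
      by (auto simp: prod_right_def bind_eq_Some_conv)
    with Q_mult_assoc[OF this] show ?thesis
      by (auto simp: prod_left_def prod_right_def)
  qed
  show "prod_right Q x y z \<noteq> None" if xy: "x \<cdot>\<^bsub>Q\<^esub> y \<noteq> None" and yz: "y \<cdot>\<^bsub>Q\<^esub> z \<noteq> None" for x y z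
  proof -
    from yz obtain v where v: "y \<cdot>\<^bsub>Q\<^esub> z = Some v"
      by blast
    moreover from xy have "R x \<preceq> D y" "x \<in> carrier C" "v \<in> carrier C"
      using Q_mult_exists_iff Q_mult_carrier v by blast+
    \<comment> \<open>Whether \<open>x\<close> can be multiplied by \<open>v\<close> depends only on
      \<open>D v\<close>, so it follows from the existence of the product with
      \<open>y\<close>.\<close>
    moreover have "D v = D y"
      using v Q_mult_iff D_of_mult by blast
    ultimately obtain w where "x \<cdot>\<^bsub>Q\<^esub> v = Some w"
      using Q_mult_exists_iff by metis
    with v show ?thesis
      by (simp add: prod_right_def)
  qed
  show "\<exists>!e. right_identity Q e \<and> e \<cdot>\<^bsub>Q\<^esub> x = Some x" if "x \<in> carrier Q" for x
    using Q_left_unit_iff that by auto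
  show "\<exists>!e. e \<in> con_range_set Q s" if "s \<in> carrier Q" for s
    using con_range_set_Q that by auto
  show "\<exists>v. con_R Q s \<cdot>\<^bsub>Q\<^esub> t = Some v \<and> con_R Q v = con_R Q u" if st: "s \<cdot>\<^bsub>Q\<^esub> t = Some u" for s t u
  proof -
    have c: "s \<in> carrier C" "u \<in> carrier C"
      using st Q_mult_carrier by blast+
    obtain t' where t': "t' \<preceq> t" "s \<cdot> t' = Some u"
      using st Q_mult_iff by blast
    \<comment> \<open>The restriction \<open>t'\<close> that computes the product of
      \<open>s\<close> and \<open>t\<close> also computes that of \<open>R s\<close> and
      \<open>t\<close>; its range is \<open>R u\<close> because
      \<open>s \<cdot> t' = u\<close>.\<close>
    then have "R s \<cdot> t' = Some t'"
      using D_mult mult_imp_R_eq_D le_carrier by metis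
    then have "R s \<cdot>\<^bsub>Q\<^esub> t = Some t'"
      using Q_mult_iff t' by blast
    then show ?thesis
      using c t' con_R_Q R_of_mult le_carrier by metis
  qed
qed

end


section \<open>From constellations to ordered categories\<close>

text \<open>The order has no carrier test of its own: the defining product, when it exists with
  value \<open>x\<close>, places \<open>x\<close> and \<open>y\<close> in the carrier.\<close>

definition ordered_category_of :: "('a, 'b) pmagma_scheme \<Rightarrow> 'a ordered_pmagma" where
  "ordered_category_of Q =
     \<lparr> carrier = carrier Q,
       pmult = (\<lambda>x y. if x \<in> carrier Q \<and> y \<in> carrier Q \<and> con_R Q x = con_D Q y
                then x \<cdot>\<^bsub>Q\<^esub> y else None),
       order_rel = {(x, y). con_D Q x \<cdot>\<^bsub>Q\<^esub> y = Some x} \<rparr>"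

lemma carrier_ordered_category_of [simp]: "carrier (ordered_category_of Q) = carrier Q"
  by (simp add: ordered_category_of_def)

context constellation
begin

abbreviation D where "D \<equiv> con_D Q"

text \<open>Q1 goes in one direction only: \<open>(x \<cdot> y) \<cdot> z\<close> may exist without
  \<open>y \<cdot> z\<close>. Hence \<open>mult_mult\<close> below assumes both inner
  products.\<close>

lemma mult_assoc:
  assumes "y \<cdot> z = Some v" "x \<cdot> v = Some w"
  obtains u where "x \<cdot> y = Some u" "u \<cdot> z = Some w"
proof -
  have "x \<in> carrier Q" "y \<in> carrier Q" "z \<in> carrier Q"
    using assms pmult_in_carrier by blast+
  then show ?thesis
    using Q1[of x y z] assms that
    by (cases "x \<cdot> y") (auto simp: prod_left_def prod_right_def)
qed

lemma mult_mult:
  assumes "x \<cdot> y = Some u" "y \<cdot> z = Some v"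
  obtains w where "x \<cdot> v = Some w" "u \<cdot> z = Some w"
proof -
  have "x \<in> carrier Q" "y \<in> carrier Q" "z \<in> carrier Q"
    using assms pmult_in_carrier by blast+
  then show ?thesis
    using Q1[of x y z] Q2[of x y z] assms that
    by (auto simp: prod_left_def prod_right_def)
qed

lemma D_props: "x \<in> carrier Q \<Longrightarrow> right_identity Q (D x) \<and> D x \<cdot> x = Some x"
  unfolding con_D_def by (rule theI') (rule Q3)

lemmas right_identity_D = D_props[THEN conjunct1]
lemmas D_mult = D_props[THEN conjunct2]

lemma D_eqI: "right_identity Q e \<Longrightarrow> e \<cdot> x = Some x \<Longrightarrow> D x = e"
  using D_props Q3 pmult_in_carrier by blast

lemma right_identity_carrier: "right_identity Q e \<Longrightarrow> e \<in> carrier Q"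
  by (simp add: right_identity_def)

lemma mult_right_identity: "right_identity Q e \<Longrightarrow> x \<cdot> e = Some y \<Longrightarrow> y = x"
  using pmult_in_carrier[of x e y] unfolding right_identity_def
  by (metis option.distinct(1) option.inject)

lemma D_carrier [simp]: "x \<in> carrier Q \<Longrightarrow> D x \<in> carrier Q"
  using right_identity_D right_identity_carrier by blast

lemma D_right_identity: "right_identity Q e \<Longrightarrow> D e = e"
  using mult_right_identity[OF _ D_mult[OF right_identity_carrier], of e] by simp

lemma D_D [simp]: "x \<in> carrier Q \<Longrightarrow> D (D x) = D x"
  using D_right_identity right_identity_D by blast

lemma D_image: "D ` carrier Q = {e. right_identity Q e}"
  using right_identity_D D_right_identity right_identity_carrier by (auto simp: image_iff) metis

lemma D_of_mult:
  assumes "x \<cdot> y = Some u"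
  shows "D u = D x"
proof -
  have x: "x \<in> carrier Q"
    using assms pmult_in_carrier by blast
  have "D x \<cdot> u = Some u"
    using mult_mult[OF D_mult[OF x] assms] assms by auto
  then show ?thesis
    using D_eqI right_identity_D x by blast
qed

text \<open>Existence of \<open>x \<cdot> y\<close> depends on \<open>y\<close> only through
  \<open>D y\<close>: apply Q1 to \<open>y = D y \<cdot> y\<close> in one direction, Q2 in the
  other.\<close>

lemma mult_D_iff:
  assumes "y \<in> carrier Q"
  shows "(\<exists>u. x \<cdot> y = Some u) \<longleftrightarrow> x \<cdot> D y = Some x"
proof
  assume "\<exists>u. x \<cdot> y = Some u"
  then obtain u where "x \<cdot> y = Some u"
    by blast
  then obtain v where "x \<cdot> D y = Some v"
    using mult_assoc[OF D_mult[OF assms]] by blast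
  then show "x \<cdot> D y = Some x"
    using mult_right_identity[OF right_identity_D[OF assms]] by simp
next
  assume "x \<cdot> D y = Some x"
  then show "\<exists>u. x \<cdot> y = Some u"
    using D_mult[OF assms] mult_mult by metis
qed

end

context constellation_with_range
begin

abbreviation R where "R \<equiv> con_R Q"
abbreviation C where "C \<equiv> ordered_category_of Q"

section \<open>Properties of the range\<close>

lemma R_in_range_set: "s \<in> carrier Q \<Longrightarrow> R s \<in> con_range_set Q s"
  unfolding con_R_def by (rule theI') (rule range_unique)

lemma range_set_iff:
  "e \<in> con_range_set Q s \<longleftrightarrow> right_identity Q e \<and> s \<cdot> e \<noteq> None \<and>
     (\<forall>f. right_identity Q f \<longrightarrow> s \<cdot> f \<noteq> None \<longrightarrow> e \<cdot> f \<noteq> None)"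
  by (simp add: con_range_set_def D_image)

lemma R_eqI: "s \<in> carrier Q \<Longrightarrow> e \<in> con_range_set Q s \<Longrightarrow> R s = e"
  using range_unique R_in_range_set by blast

lemma right_identity_R: "s \<in> carrier Q \<Longrightarrow> right_identity Q (R s)"
  using R_in_range_set range_set_iff by blast

lemma mult_R: "s \<in> carrier Q \<Longrightarrow> s \<cdot> R s = Some s"
  using R_in_range_set range_set_iff mult_right_identity by blast

lemma R_carrier [simp]: "s \<in> carrier Q \<Longrightarrow> R s \<in> carrier Q"
  using right_identity_R right_identity_carrier by blast

lemma D_R [simp]: "s \<in> carrier Q \<Longrightarrow> D (R s) = R s"
  using D_right_identity right_identity_R by blast

lemma R_right_identity: "right_identity Q e \<Longrightarrow> R e = e"
  using R_eqI range_set_iff D_mult D_right_identity right_identity_carrier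
  by (metis option.distinct(1))

lemma R_D [simp]: "x \<in> carrier Q \<Longrightarrow> R (D x) = D x"
  using R_right_identity right_identity_D by blast

text \<open>In a general constellation \<open>\<le>\<close> is only a preorder on \<open>D(Q)\<close>; antisymmetry comes from the
  uniqueness of ranges, because elements equivalent to \<open>e\<close> are all ranges of \<open>e\<close>.\<close>

lemma right_identity_antisym:
  assumes "right_identity Q e" "right_identity Q f" "e \<cdot> f = Some e" "f \<cdot> e = Some f"
  shows "e = f"
proof -
  have "f \<cdot> g \<noteq> None" if g: "e \<cdot> g \<noteq> None" for g
  proof -
    from g obtain v where "e \<cdot> g = Some v"
      by blast
    from mult_mult[OF assms(4) this] show ?thesis
      by (metis option.distinct(1))
  qed
  then have "f \<in> con_range_set Q e"
    using assms range_set_iff by auto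
  then show ?thesis
    using R_eqI R_right_identity assms right_identity_carrier by metis
qed

text \<open>Existence also depends on \<open>x\<close> only through \<open>R x\<close>. Minimality
  of \<open>R x\<close> among the right identities that \<open>x\<close> can be multiplied by gives
  one direction; Q2 through \<open>x \<cdot> R x\<close> gives the other.\<close>

lemma mult_R_iff:
  assumes "x \<in> carrier Q" "y \<in> carrier Q"
  shows "(\<exists>u. x \<cdot> y = Some u) \<longleftrightarrow> R x \<cdot> D y = Some (R x)"
proof
  assume "\<exists>u. x \<cdot> y = Some u"
  then have "x \<cdot> D y \<noteq> None"
    using mult_D_iff assms by auto
  then have "R x \<cdot> D y \<noteq> None"
    using R_in_range_set range_set_iff right_identity_D assms by blast
  then show "R x \<cdot> D y = Some (R x)"
    using mult_right_identity right_identity_D assms by blast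
next
  assume "R x \<cdot> D y = Some (R x)"
  from mult_mult[OF mult_R[OF assms(1)] this] have "x \<cdot> D y = Some x"
    using mult_right_identity right_identity_D assms by metis
  then show "\<exists>u. x \<cdot> y = Some u"
    using mult_D_iff assms by blast
qed

text \<open>Here \<open>v\<close> is the restriction of \<open>y\<close> to \<open>R x\<close>.
  Replacing \<open>y\<close> by \<open>v\<close> keeps the product and makes the factors match
  exactly.\<close>

lemma R_mult_mult:
  assumes "x \<cdot> y = Some u" "R x \<cdot> y = Some v"
  shows "x \<cdot> v = Some u" "R v = R u"
proof -
  have x: "x \<in> carrier Q"
    using assms pmult_in_carrier by blast
  show "x \<cdot> v = Some u"
    using mult_mult[OF mult_R[OF x] assms(2)] assms by auto
  show "R v = R u"
    using range_congruence[OF assms(1)] assms(2) by auto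
qed

text \<open>Under the second hypothesis \<open>R x \<cdot> y = y\<close>, so range congruence
  compares \<open>u\<close> with \<open>y\<close> itself.\<close>

lemma R_of_mult_composable:
  assumes "x \<cdot> y = Some u" "R x = D y"
  shows "R u = R y"
  using R_mult_mult(2)[OF assms(1)] assms D_mult pmult_in_carrier by metis

text \<open>\<open>u \<cdot> R y\<close> exists because \<open>y \<cdot> R y\<close> does, and
  \<open>mult_R_iff\<close> passes from \<open>u\<close> to \<open>R u\<close>. This is the source
  of O2'.\<close>

lemma R_of_mult_le:
  assumes "x \<cdot> y = Some u"
  shows "R u \<cdot> R y = Some (R u)"
proof -
  have c: "y \<in> carrier Q" "u \<in> carrier Q"
    using assms pmult_in_carrier by blast+
  obtain w where "u \<cdot> R y = Some w"
    using mult_mult[OF assms mult_R[OF c(1)]] by blast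
  then show ?thesis
    using mult_R_iff[of u "R y"] c by auto
qed

section \<open>Composition and identities in the category\<close>

lemma C_mult_iff:
  "x \<cdot>\<^bsub>C\<^esub> y = Some u \<longleftrightarrow> x \<cdot> y = Some u \<and> R x = D y"
  using pmult_in_carrier by (auto simp: ordered_category_of_def)

lemma C_mult_exists_iff:
  assumes "x \<in> carrier Q" "y \<in> carrier Q"
  shows "x \<cdot>\<^bsub>C\<^esub> y \<noteq> None \<longleftrightarrow> R x = D y"
  using C_mult_iff mult_R_iff[OF assms] D_mult assms D_D by (metis D_carrier not_Some_eq)

lemma C_le_iff: "(x, y) \<in> order_rel C \<longleftrightarrow> D x \<cdot> y = Some x"
  by (simp add: ordered_category_of_def)

lemma right_identity_C: "right_identity C e \<Longrightarrow> right_identity Q e"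
proof -
  assume e: "right_identity C e"
  then have c: "e \<in> carrier Q"
    by (simp add: right_identity_def)
  then have "D e \<cdot>\<^bsub>C\<^esub> e = Some e"
    using C_mult_iff D_mult by simp
  then have "e = D e"
    using e c by (auto simp: right_identity_def)
  then show ?thesis
    using right_identity_D[OF c] by simp
qed

text \<open>A right identity of a constellation need not act trivially from the left. In
  \<open>C\<close> it does, because composability of \<open>e\<close> with \<open>x\<close> forces
  \<open>e = D x\<close>.\<close>

lemma identity_C_iff: "identity C e \<longleftrightarrow> right_identity Q e"
proof
  show "right_identity Q e" if "identity C e"
    using that right_identity_C by (simp add: identity_def)
next
  assume e: "right_identity Q e"
  then have c: "e \<in> carrier Q"
    by (rule right_identity_carrier)
  have "x \<cdot>\<^bsub>C\<^esub> e = Some x" if "x \<in> carrier Q" "x \<cdot>\<^bsub>C\<^esub> e \<noteq> None" for x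
    using that e C_mult_iff mult_right_identity by blast
  moreover have "e \<cdot>\<^bsub>C\<^esub> x = Some x" if "x \<in> carrier Q" "e \<cdot>\<^bsub>C\<^esub> x \<noteq> None" for x
  proof -
    have "e = D x"
      using C_mult_exists_iff[OF c that(1)] that(2) R_right_identity[OF e] by simp
    then show ?thesis
      using C_mult_iff D_mult that by simp
  qed
  ultimately show "identity C e"
    using c by (simp add: identity_def right_identity_def)
qed

lemma cat_D_C:
  assumes "x \<in> carrier Q"
  shows "cat_D C x = D x"
  unfolding cat_D_def
proof (rule the_equality)
  show "identity C (D x) \<and> D x \<cdot>\<^bsub>C\<^esub> x \<noteq> None"
    using identity_C_iff right_identity_D C_mult_exists_iff assms by simp
  show "e = D x" if "identity C e \<and> e \<cdot>\<^bsub>C\<^esub> x \<noteq> None" for e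
    using that identity_C_iff C_mult_exists_iff R_right_identity right_identity_carrier assms
    by metis
qed

lemma cat_R_C:
  assumes "x \<in> carrier Q"
  shows "cat_R C x = R x"
  unfolding cat_R_def
proof (rule the_equality)
  show "identity C (R x) \<and> x \<cdot>\<^bsub>C\<^esub> R x \<noteq> None"
    using identity_C_iff right_identity_R C_mult_exists_iff assms by simp
  show "e = R x" if "identity C e \<and> x \<cdot>\<^bsub>C\<^esub> e \<noteq> None" for e
    using that identity_C_iff C_mult_exists_iff D_right_identity right_identity_carrier assms
    by metis
qed

section \<open>The order on the category\<close>

lemma C_le_carrier: "(x, y) \<in> order_rel C \<Longrightarrow> x \<in> carrier Q \<and> y \<in> carrier Q"
  using C_le_iff pmult_in_carrier by blast

text \<open>Existence of \<open>D x \<cdot> y\<close> gives \<open>D x \<cdot> D y = D x\<close>;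
  multiplying by \<open>z\<close> yields \<open>D x \<cdot> z = D x \<cdot> y = x\<close>.\<close>

lemma C_le_trans:
  assumes "(x, y) \<in> order_rel C" "(y, z) \<in> order_rel C"
  shows "(x, z) \<in> order_rel C"
proof -
  have c: "x \<in> carrier Q" "y \<in> carrier Q"
    using assms C_le_carrier by blast+
  have xy: "D x \<cdot> y = Some x" and yz: "D y \<cdot> z = Some y"
    using assms C_le_iff by simp_all
  then have "D x \<cdot> D y = Some (D x)"
    using mult_D_iff c by blast
  from mult_mult[OF this yz] have "D x \<cdot> z = Some x"
    using xy by auto
  then show ?thesis
    using C_le_iff by simp
qed

text \<open>The domains agree by antisymmetry on right identities, so
  \<open>x = D x \<cdot> y = D y \<cdot> y = y\<close>.\<close>

lemma C_le_antisym:
  assumes "(x, y) \<in> order_rel C" "(y, x) \<in> order_rel C"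
  shows "x = y"
proof -
  have c: "x \<in> carrier Q" "y \<in> carrier Q"
    using assms C_le_carrier by blast+
  have xy: "D x \<cdot> y = Some x" "D y \<cdot> x = Some y"
    using assms C_le_iff by simp_all
  then have "D x \<cdot> D y = Some (D x)" "D y \<cdot> D x = Some (D y)"
    using mult_D_iff c by blast+
  then have "D x = D y"
    using right_identity_antisym right_identity_D c by blast
  then show ?thesis
    using xy D_mult[OF c(2)] by (metis option.inject)
qed

section \<open>The axioms of an ordered category with restrictions\<close>

lemma object_free_category_C: "object_free_category C"
proof unfold_locales
  show "x \<in> carrier C \<and> y \<in> carrier C \<and> z \<in> carrier C" if "x \<cdot>\<^bsub>C\<^esub> y = Some z" for x y z
    using that C_mult_iff pmult_in_carrier unfolding carrier_ordered_category_of by blast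
  show "(prod_right C x y z \<noteq> None \<longleftrightarrow> prod_left C x y z \<noteq> None)
      \<and> (prod_right C x y z \<noteq> None \<longrightarrow> prod_right C x y z = prod_left C x y z)" for x y z
  proof -
    have right: "prod_left C x y z = Some w" if "prod_right C x y z = Some w" for w
    proof -
      from that obtain v where v: "y \<cdot> z = Some v" "R y = D z" "x \<cdot> v = Some w" "R x = D v"
        using C_mult_iff by (auto simp: prod_right_def bind_eq_Some_conv)
      then obtain u where "x \<cdot> y = Some u" "u \<cdot> z = Some w"
        using mult_assoc by blast
      moreover from this have "R x = D y" "R u = D z"
        using v D_of_mult R_of_mult_composable by metis+
      ultimately show ?thesis
        using C_mult_iff by (auto simp: prod_left_def bind_eq_Some_conv)
    qed
    \<comment> \<open>Q1 has no converse, so existence is recovered from matching ranges and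
      domains; the equality of the two products comes from \<open>right\<close>.\<close>
    have left: "prod_right C x y z \<noteq> None" if "prod_left C x y z = Some w" for w
    proof -
      from that obtain u where u: "x \<cdot> y = Some u" "R x = D y" "u \<cdot> z = Some w" "R u = D z"
        using C_mult_iff by (auto simp: prod_left_def bind_eq_Some_conv)
      then have yz: "R y = D z"
        using R_of_mult_composable by metis
      obtain v where v: "y \<cdot>\<^bsub>C\<^esub> z = Some v"
        using C_mult_exists_iff yz u pmult_in_carrier by (metis not_Some_eq)
      then have "R x = D v"
        using u C_mult_iff D_of_mult by metis
      then have "x \<cdot>\<^bsub>C\<^esub> v \<noteq> None"
        using C_mult_exists_iff u v C_mult_iff pmult_in_carrier by metis
      then show ?thesis
        using v by (simp add: prod_right_def)
    qed
    show ?thesis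
      using left right by fastforce
  qed
  show "prod_right C x y z \<noteq> None" if xy: "x \<cdot>\<^bsub>C\<^esub> y \<noteq> None" and yz: "y \<cdot>\<^bsub>C\<^esub> z \<noteq> None" for x y z
  proof -
    from xy yz obtain u v where uv: "x \<cdot>\<^bsub>C\<^esub> y = Some u" "y \<cdot>\<^bsub>C\<^esub> z = Some v"
      by blast
    then have "R x = D v"
      using C_mult_iff D_of_mult by metis
    then have "x \<cdot>\<^bsub>C\<^esub> v \<noteq> None"
      using C_mult_exists_iff uv C_mult_iff pmult_in_carrier by metis
    then show ?thesis
      using uv by (simp add: prod_right_def)
  qed
  show "\<exists>e f. identity C e \<and> identity C f \<and> e \<cdot>\<^bsub>C\<^esub> x \<noteq> None \<and> x \<cdot>\<^bsub>C\<^esub> f \<noteq> None"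
    if "x \<in> carrier C" for x
  proof (intro exI conjI)
    have x: "x \<in> carrier Q"
      using that by simp
    show "identity C (D x)" "identity C (R x)"
      using identity_C_iff right_identity_D right_identity_R x by blast+
    show "D x \<cdot>\<^bsub>C\<^esub> x \<noteq> None" "x \<cdot>\<^bsub>C\<^esub> R x \<noteq> None"
      using C_mult_exists_iff x by simp_all
  qed
qed

lemma ordered_category_with_restrictions_C: "ordered_category_with_restrictions C"
proof (intro ordered_category_with_restrictions.intro object_free_category_C
    ordered_category_with_restrictions_axioms.intro)
  show "partial_order_on (carrier C) (order_rel C)"
    unfolding partial_order_on_def preorder_on_def
  proof (intro conjI)
    show "order_rel C \<subseteq> carrier C \<times> carrier C"
      using C_le_carrier by auto
    show "refl_on (carrier C) (order_rel C)"
      using C_le_iff D_mult by (auto simp: refl_on_def)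
    show "trans (order_rel C)"
      using C_le_trans by (rule transI)
    show "antisym (order_rel C)"
      using C_le_antisym by (rule antisymI)
  qed
  show "(u, v) \<in> order_rel C"
    if ab: "(a, b) \<in> order_rel C" and cd: "(c, d) \<in> order_rel C"
      and u: "a \<cdot>\<^bsub>C\<^esub> c = Some u" and v: "b \<cdot>\<^bsub>C\<^esub> d = Some v" for a b c d u v
  proof -
    have carr: "a \<in> carrier Q" "c \<in> carrier Q"
      using ab cd C_le_carrier by blast+
    have "D c \<cdot> d = Some c" "a \<cdot> c = Some u"
      using cd u C_le_iff C_mult_iff by auto
    \<comment> \<open>As \<open>c = D c \<cdot> d\<close>, Q1 regroups \<open>a \<cdot> c\<close> as
      \<open>(a \<cdot> D c) \<cdot> d\<close>, and \<open>a \<cdot> D c = a\<close>.\<close>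
    then have "a \<cdot> d = Some u"
      using mult_assoc mult_right_identity[OF right_identity_D[OF carr(2)]] by metis
    moreover have "D a \<cdot> b = Some a" "b \<cdot> d = Some v"
      using ab v C_le_iff C_mult_iff by auto
    ultimately have "D a \<cdot> v = Some u"
      using mult_mult[of "D a" b a d v] by auto
    moreover have "D u = D a"
      using u C_mult_iff D_of_mult by blast
    ultimately show ?thesis
      using C_le_iff by simp
  qed
  show "(cat_D C a, cat_D C b) \<in> order_rel C" if "(a, b) \<in> order_rel C" for a b
  proof -
    have c: "a \<in> carrier Q" "b \<in> carrier Q"
      using that C_le_carrier by blast+
    then show ?thesis
      using that mult_D_iff[OF c(2), of "D a"] by (auto simp: C_le_iff cat_D_C)
  qed
  show "(cat_R C a, cat_R C b) \<in> order_rel C" if "(a, b) \<in> order_rel C" for a b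
  proof -
    have c: "a \<in> carrier Q" "b \<in> carrier Q"
      using that C_le_carrier by blast+
    then show ?thesis
      using that R_of_mult_le[of "D a" b a] by (simp add: C_le_iff cat_R_C)
  qed
  show "\<exists>!x. x \<in> carrier C \<and> (x, s) \<in> order_rel C \<and> cat_D C x = e"
    if s: "s \<in> carrier C" and e: "e \<in> cat_D C ` carrier C"
      and le: "(e, cat_D C s) \<in> order_rel C" for s e
  proof -
    have sQ: "s \<in> carrier Q"
      using s by simp
    have eQ: "e \<in> carrier Q" "D e = e"
      using e by (auto simp: cat_D_C)
    have "e \<cdot> D s = Some e"
      using le sQ eQ by (simp add: C_le_iff cat_D_C)
    \<comment> \<open>The restriction of \<open>s\<close> to \<open>e\<close> is the product
      \<open>e \<cdot> s\<close>; by definition of the order, any competitor with domain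
      \<open>e\<close> equals this product.\<close>
    then obtain x where x: "e \<cdot> s = Some x"
      using mult_D_iff sQ by blast
    show ?thesis
    proof (rule ex1I)
      show "x \<in> carrier C \<and> (x, s) \<in> order_rel C \<and> cat_D C x = e"
        using x pmult_in_carrier[OF x] D_of_mult[OF x] eQ by (simp add: C_le_iff cat_D_C)
      show "y = x" if "y \<in> carrier C \<and> (y, s) \<in> order_rel C \<and> cat_D C y = e" for y
        using that x by (auto simp: C_le_iff cat_D_C)
    qed
  qed
qed

end


section \<open>The constructions are mutually inverse\<close>

text \<open>A witness \<open>y'\<close> for the product of \<open>D x\<close> and \<open>y\<close>
  with value \<open>x\<close> satisfies \<open>D x \<cdot> y' = x\<close>, so it can only be
  \<open>x\<close> itself.\<close>

lemma (in ordered_category_with_restrictions) order_rel_iff: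
  "x \<preceq> y \<longleftrightarrow> con_D Q x \<cdot>\<^bsub>Q\<^esub> y = Some x"
proof
  assume le: "x \<preceq> y"
  then have "x \<in> carrier C"
    using le_carrier by blast
  then show "con_D Q x \<cdot>\<^bsub>Q\<^esub> y = Some x"
    using le D_mult Q_mult_iff con_D_Q by metis
next
  assume *: "con_D Q x \<cdot>\<^bsub>Q\<^esub> y = Some x"
  then have x: "x \<in> carrier C"
    using Q_mult_carrier by blast
  with * obtain y' where y': "y' \<preceq> y" "D x \<cdot> y' = Some x"
    using Q_mult_iff con_D_Q by auto
  then have "x = y'"
    using identity_mult_left identity_D x by blast
  then show "x \<preceq> y"
    using y' by simp
qed

text \<open>When range and domain match exactly, the restriction of \<open>y\<close> is
  \<open>y\<close>, so both products agree.\<close>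

lemma (in ordered_category_with_restrictions) mult_eq_Q_mult:
  "x \<cdot> y = (if x \<in> carrier C \<and> y \<in> carrier C \<and> R x = D y then x \<cdot>\<^bsub>Q\<^esub> y else None)"
proof (cases "x \<cdot> y")
  case None
  then show ?thesis
    using mult_iff[of x y] by auto
next
  case (Some u)
  have "x \<in> carrier C" "y \<in> carrier C"
    using pmult_in_carrier[OF Some] by blast+
  moreover from this have "x \<cdot>\<^bsub>Q\<^esub> y = Some u"
    using Some Q_mult_iff le_refl by blast
  ultimately show ?thesis
    using Some mult_imp_R_eq_D[OF Some] by simp
qed

lemma ordered_category_of_constellation_of:
  fixes C :: "'a ordered_pmagma"
  assumes "ordered_category_with_restrictions C"
  shows "ordered_category_of (constellation_of C) = C"
proof -
  interpret ordered_category_with_restrictions C by fact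
  have "pmult (ordered_category_of Q) = pmult C"
    by (intro ext) (subst mult_eq_Q_mult, auto simp: ordered_category_of_def con_D_Q con_R_Q)
  moreover have "order_rel (ordered_category_of Q) = order_rel C"
    using order_rel_iff by (auto simp: ordered_category_of_def)
  ultimately show ?thesis
    by (intro ordered_pmagma.equality) simp_all
qed

text \<open>A witness \<open>y'\<close> has domain \<open>R x\<close> and equals
  \<open>R x \<cdot> y\<close>, so Q1 turns \<open>x \<cdot> y'\<close> into
  \<open>x \<cdot> y\<close>. Conversely, range congruence supplies the witness
  \<open>v = R x \<cdot> y\<close>.\<close>

lemma (in constellation_with_range) constellation_of_C_mult:
  "x \<cdot>\<^bsub>constellation_of C\<^esub> y = Some u \<longleftrightarrow> x \<cdot> y = Some u"
proof -
  interpret cat: ordered_category_with_restrictions C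
    by (rule ordered_category_with_restrictions_C)
  show ?thesis
  proof
    assume "x \<cdot>\<^bsub>constellation_of C\<^esub> y = Some u"
    then obtain y' where y': "D y' \<cdot> y = Some y'" "x \<cdot> y' = Some u" "R x = D y'"
      using cat.Q_mult_iff C_le_iff C_mult_iff by auto
    then have "x \<in> carrier Q"
      using pmult_in_carrier by blast
    then show "x \<cdot> y = Some u"
      using mult_assoc[OF y'(1,2)] mult_R y'(3) by (metis option.inject)
  next
    assume xy: "x \<cdot> y = Some u"
    then have x: "x \<in> carrier Q"
      using pmult_in_carrier by blast
    obtain v where v: "R x \<cdot> y = Some v"
      using range_congruence[OF xy] by blast
    have "D v = R x"
      using D_of_mult[OF v] x by simp
    then have "(v, y) \<in> order_rel C" "x \<cdot>\<^bsub>C\<^esub> v = Some u"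
      using v R_mult_mult[OF xy v] C_le_iff C_mult_iff by simp_all
    then show "x \<cdot>\<^bsub>constellation_of C\<^esub> y = Some u"
      using cat.Q_mult_iff by blast
  qed
qed

lemma constellation_of_ordered_category_of:
  fixes Q :: "'a pmagma"
  assumes "constellation_with_range Q"
  shows "constellation_of (ordered_category_of Q) = Q"
proof -
  interpret constellation_with_range Q by fact
  have "pmult (constellation_of C) = pmult Q"
    using constellation_of_C_mult by (intro ext option.expand) (metis not_Some_eq option.sel)+
  then show ?thesis
    by (intro pmagma.equality) simp_all
qed


section \<open>Morphisms\<close>

text \<open>Preserving both order and composition, \<open>\<rho>\<close> carries a witness for a
  product in the first constellation to one in the second.\<close>

lemma range_radiant_constellation_of:
  fixes A B :: "'a ordered_pmagma"
  assumes A: "ordered_category_with_restrictions A" and B: "ordered_category_with_restrictions B"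
    and \<rho>: "order_preserving_functor A B \<rho>"
  shows "range_radiant (constellation_of A) (constellation_of B) \<rho>"
proof -
  interpret A: ordered_category_with_restrictions A by fact
  interpret B: ordered_category_with_restrictions B by fact
  have "\<rho> s \<in> carrier B" if "s \<in> carrier A" for s
    using \<rho> that by (auto simp: order_preserving_functor_def)
  moreover have "\<rho> s \<cdot>\<^bsub>B.Q\<^esub> \<rho> t = Some (\<rho> u)" if "s \<cdot>\<^bsub>A.Q\<^esub> t = Some u" for s t u
    using that \<rho> unfolding A.Q_mult_iff B.Q_mult_iff order_preserving_functor_def by blast
  ultimately show ?thesis
    using \<rho> by (auto simp: range_radiant_def order_preserving_functor_def
        A.con_D_Q A.con_R_Q B.con_D_Q B.con_R_Q)
qed

text \<open>Composability and order are expressed through domains, ranges and products, all of which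
  \<open>\<rho>\<close> preserves.\<close>

lemma order_preserving_functor_ordered_category_of:
  fixes A B :: "'a pmagma"
  assumes A: "constellation_with_range A" and B: "constellation_with_range B"
    and \<rho>: "range_radiant A B \<rho>"
  shows "order_preserving_functor (ordered_category_of A) (ordered_category_of B) \<rho>"
proof -
  interpret A: constellation_with_range A by fact
  interpret B: constellation_with_range B by fact
  have c: "\<rho> s \<in> carrier B" if "s \<in> carrier A" for s
    using \<rho> that by (auto simp: range_radiant_def)
  have D: "B.D (\<rho> s) = \<rho> (A.D s)" and R: "B.R (\<rho> s) = \<rho> (A.R s)" if "s \<in> carrier A" for s
    using \<rho> that by (auto simp: range_radiant_def)
  have mult: "\<rho> s \<cdot>\<^bsub>B\<^esub> \<rho> t = Some (\<rho> u)" if "s \<cdot>\<^bsub>A\<^esub> t = Some u" for s t u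
    using \<rho> that by (auto simp: range_radiant_def)
  have "\<rho> s \<cdot>\<^bsub>B.C\<^esub> \<rho> t = Some (\<rho> u)" if "s \<cdot>\<^bsub>A.C\<^esub> t = Some u" for s t u
    using that mult D R A.pmult_in_carrier by (auto simp: A.C_mult_iff B.C_mult_iff)
  moreover have "(\<rho> s, \<rho> t) \<in> order_rel B.C" if "(s, t) \<in> order_rel A.C" for s t
    using that mult D A.pmult_in_carrier by (auto simp: A.C_le_iff B.C_le_iff)
  ultimately show ?thesis
    using \<rho> c D R by (auto simp: range_radiant_def order_preserving_functor_def
        A.cat_D_C A.cat_R_C B.cat_D_C B.cat_R_C)
qed


section \<open>The isomorphism\<close>

lemma is_category_category_of_structures:
  assumes map: "\<And>A B \<rho>. \<lbrakk>A \<in> S; B \<in> S; H A B \<rho>\<rbrakk> \<Longrightarrow> \<rho> \<in> U A \<rightarrow>\<^sub>E U B"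
    and ident: "\<And>A. A \<in> S \<Longrightarrow> H A A (restrict id (U A))"
    and comp: "\<And>A B C \<rho> \<sigma>. \<lbrakk>A \<in> S; B \<in> S; C \<in> S; H A B \<rho>; H B C \<sigma>\<rbrakk>
      \<Longrightarrow> H A C (compose (U A) \<sigma> \<rho>)"
  shows "is_category (category_of_structures U S H)"
proof
  fix f assume "f \<in> Arr (category_of_structures U S H)"
  then obtain A \<rho> B where f: "f = (A, \<rho>, B)" "A \<in> S" "B \<in> S" "H A B \<rho>"
    by (auto simp: category_of_structures_def)
  \<comment> \<open>Extensionality matters here: outside \<open>U A\<close> both composites and
    \<open>\<rho>\<close> take the value \<open>undefined\<close>.\<close>
  then have "compose (U A) \<rho> (restrict id (U A)) = \<rho>" "compose (U A) (restrict id (U B)) \<rho> = \<rho>"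
    using map[of A B \<rho>] by (auto simp: compose_def restrict_def PiE_iff extensional_def fun_eq_iff)
  with f show "Comp (category_of_structures U S H)
        (Ident (category_of_structures U S H) (Dom (category_of_structures U S H) f)) f = f \<and>
      Comp (category_of_structures U S H) f
        (Ident (category_of_structures U S H) (Cod (category_of_structures U S H) f)) = f"
    by (simp add: category_of_structures_def)
next
  fix f g h
  assume "f \<in> Arr (category_of_structures U S H)" "g \<in> Arr (category_of_structures U S H)"
    "h \<in> Arr (category_of_structures U S H)"
    "Cod (category_of_structures U S H) f = Dom (category_of_structures U S H) g"
    "Cod (category_of_structures U S H) g = Dom (category_of_structures U S H) h"
  then obtain A \<rho> B \<sigma> C \<tau> E where "f = (A, \<rho>, B)" "g = (B, \<sigma>, C)" "h = (C, \<tau>, E)"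
      "A \<in> S" "B \<in> S" "H A B \<rho>"
    by (auto simp: category_of_structures_def)
  moreover from this have "\<rho> \<in> U A \<rightarrow> U B"
    using map by blast
  ultimately show "Comp (category_of_structures U S H) (Comp (category_of_structures U S H) f g) h =
      Comp (category_of_structures U S H) f (Comp (category_of_structures U S H) g h)"
    by (simp add: category_of_structures_def compose_assoc)
qed (use ident comp in \<open>auto simp: category_of_structures_def\<close>)

lemma is_category_ordered_categories_with_restrictions:
  "is_category ordered_categories_with_restrictions"
  unfolding ordered_categories_with_restrictions_def
proof (rule is_category_category_of_structures; unfold mem_Collect_eq)
  fix A :: "'a ordered_pmagma"
  assume "ordered_category_with_restrictions A"
  then interpret A: ordered_category_with_restrictions A .
  show "order_preserving_functor A A (restrict id (carrier A))"
    using A.pmult_in_carrier A.le_carrier by (auto simp: order_preserving_functor_def)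
next
  fix A B C :: "'a ordered_pmagma" and \<rho> \<sigma>
  assume "ordered_category_with_restrictions A" and \<rho>: "order_preserving_functor A B \<rho>"
    and \<sigma>: "order_preserving_functor B C \<sigma>"
  then interpret A: ordered_category_with_restrictions A by simp
  show "order_preserving_functor A C (compose (carrier A) \<sigma> \<rho>)"
    using \<rho> \<sigma> A.pmult_in_carrier A.le_carrier
    by (auto simp: order_preserving_functor_def compose_def PiE_iff)
qed (simp add: order_preserving_functor_def)

lemma is_category_constellations_with_range: "is_category constellations_with_range"
  unfolding constellations_with_range_def
proof (rule is_category_category_of_structures; unfold mem_Collect_eq)
  fix A :: "'a pmagma"
  assume "constellation_with_range A"
  then interpret A: constellation_with_range A .
  show "range_radiant A A (restrict id (carrier A))"
    using A.pmult_in_carrier by (auto simp: range_radiant_def)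
next
  fix A B C :: "'a pmagma" and \<rho> \<sigma>
  assume "constellation_with_range A" and \<rho>: "range_radiant A B \<rho>"
    and \<sigma>: "range_radiant B C \<sigma>"
  then interpret A: constellation_with_range A by simp
  show "range_radiant A C (compose (carrier A) \<sigma> \<rho>)"
    using \<rho> \<sigma> A.pmult_in_carrier by (auto simp: range_radiant_def compose_def PiE_iff)
qed (simp add: range_radiant_def)

text \<open>Arrows keep their underlying map. The identity and composite maps are built from
  carriers, so agreement of \<open>U\<close> and \<open>V\<close> makes them correspond.\<close>

lemma is_functor_category_of_structures:
  assumes "\<And>A. A \<in> S \<Longrightarrow> F A \<in> T \<and> V (F A) = U A"
    and "\<And>A B \<rho>. \<lbrakk>A \<in> S; B \<in> S; H A B \<rho>\<rbrakk> \<Longrightarrow> J (F A) (F B) \<rho>"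
  shows "is_functor (category_of_structures U S H) (category_of_structures V T J)
    F (\<lambda>(A, \<rho>, B). (F A, \<rho>, F B))"
  using assms by (auto simp: is_functor_def category_of_structures_def)

theorem theorem5p10:
  shows "isomorphic_categories
    (ordered_categories_with_restrictions :: ('a ordered_pmagma, 'a ordered_pmagma_arrow) cat)
    (constellations_with_range :: ('a pmagma, 'a pmagma_arrow) cat)"
  unfolding isomorphic_categories_def
proof (intro conjI exI)
  let ?K = "ordered_categories_with_restrictions :: ('a ordered_pmagma, 'a ordered_pmagma_arrow) cat"
  let ?L = "constellations_with_range :: ('a pmagma, 'a pmagma_arrow) cat"
  let ?F = "constellation_of :: 'a ordered_pmagma \<Rightarrow> 'a pmagma"
  let ?G = "ordered_category_of :: 'a pmagma \<Rightarrow> 'a ordered_pmagma"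
  \<comment> \<open>Only source and target are transported, so inverseness on arrows reduces to
    inverseness on objects.\<close>
  let ?Fm = "\<lambda>(A, \<rho> :: 'a \<Rightarrow> 'a, B). (?F A, \<rho>, ?F B)"
  let ?Gm = "\<lambda>(A, \<rho> :: 'a \<Rightarrow> 'a, B). (?G A, \<rho>, ?G B)"
  note defs = ordered_categories_with_restrictions_def constellations_with_range_def
    category_of_structures_def
  show "is_category ?K" "is_category ?L"
    by (rule is_category_ordered_categories_with_restrictions
        is_category_constellations_with_range)+
  show "is_functor ?K ?L ?F ?Fm"
    unfolding ordered_categories_with_restrictions_def constellations_with_range_def
    by (rule is_functor_category_of_structures)
      (auto intro: ordered_category_with_restrictions.constellation_with_range_Q
        range_radiant_constellation_of)
  show "is_functor ?L ?K ?G ?Gm"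
    unfolding ordered_categories_with_restrictions_def constellations_with_range_def
    by (rule is_functor_category_of_structures)
      (auto intro: constellation_with_range.ordered_category_with_restrictions_C
        order_preserving_functor_ordered_category_of)
  show "\<forall>X\<in>Obj ?K. ?G (?F X) = X" "\<forall>f\<in>Arr ?K. ?Gm (?Fm f) = f"
    by (auto simp: defs ordered_category_of_constellation_of)
  show "\<forall>Y\<in>Obj ?L. ?F (?G Y) = Y" "\<forall>g\<in>Arr ?L. ?Fm (?Gm g) = g"
    by (auto simp: defs constellation_of_ordered_category_of)
qed

end
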